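(* Let $k\geq 2$. The function $L_k(s)$ extends meromorphically to $\mathbb{C}$ and has at most simple poles, located at $s=\frac{k}{2}-n$ with $n$ a nonnegative integer. Moreover, for every nonnegative integer $n$, \[ \mathrm{Res}_{s=\frac{k}{2}-n}L_k(s)=\frac{1}{ 4(k-1)!}\sum_{h=0}^{\min\left\{n,\left[\frac{k-2}{2}\right]\right\}}(-1)^{n-h}\left(\frac{k-1}{2}\right)^{2n-2h}\binom{n-\frac{k}{2}}{n-h}B_{k,k-2h-1}. \] In particular $\mathrm{Res}_{s=\frac{k}{2}}L_k(s)=\frac{1}{2(k-1)!}$. Furthermore, when $k$ is even, $L_k(s)$ has at most simple poles, located only at $s=1,\ldots,\frac{k}{2}$.
   Context: For an integer $k\ge 2$, $P_k(x)=\frac{(2x+k-1)(x+1)(x+2)\cdots(x+k-2)}{(k-1)!}$ (for $k=2$ the product $(x+1)\cdots(x+k-2)$ is empty). The Minakshisundaram–Pleijel zeta function of the real projective space $P^k$ is $L_k(s)=\sum_{n=1}^{\infty}\frac{P_k(2n)}{[2n(2n+k-1)]^s}$ for $\mathrm{Re}\,s>k/2$. The constants $B_{k,j}$, $0\le j\le k-1$, are given by $B_{k,j}=\sum_{p=0}^{k-j-1}(-1)^{k+j+1}\binom{j+p}{j}\left(\frac{k-1}{2}\right)^p\left(s_{k,j+p+1}+s_{k-1,j+p}\right)$, where the Stirling numbers of the first kind are defined by $x(x+1)\cdots(x+n-1)=\sum_{m=0}^{n}(-1)^{n+m}s_{n,m}x^m$; equivalently $\sum_{j=0}^{k-1}B_{k,j}x^j=(k-1)!\,P_k\!\left(x-\frac{k-1}{2}\right)$.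 For real $a$ and integer $m\ge 0$, $\binom{a}{m}=\frac{a(a-1)\cdots(a-m+1)}{m!}$; $[x]$ is the integer part of $x$. *)

theory Defs
  imports "HOL-Complex_Analysis.Complex_Analysis" "HOL-Combinatorics.Stirling"
begin

definition P_poly :: "nat \<Rightarrow> real \<Rightarrow> real" where
  "P_poly k x = (2 * x + real k - 1) * (\<Prod>i=1..k-2. x + real i) / fact (k - 1)"

(* The library's "stirling n m" is the unsigned number of the first kind; the lemma
   signed_stirling_generating shows that the signed version below satisfies the
   defining generating identity. *)
definition signed_stirling :: "nat \<Rightarrow> nat \<Rightarrow> int" where
  "signed_stirling n m = (-1) ^ (n + m) * int (stirling n m)"

lemma signed_stirling_generating:
  fixes x :: real
  shows "(\<Prod>i<n. x + real i) =
           (\<Sum>m=0..n. (-1) ^ (n + m) * of_int (signed_stirling n m) * x ^ m)"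
proof -
  have "(\<Prod>i<n. x + real i) = pochhammer x n"
    by (simp add: pochhammer_prod atLeast0LessThan)
  also have "\<dots> = (\<Sum>m\<le>n. of_nat (stirling n m) * x ^ m)"
    by (simp add: stirling_pochhammer)
  also have "\<dots> = (\<Sum>m=0..n. (-1) ^ (n + m) * of_int (signed_stirling n m) * x ^ m)"
    by (rule sum.cong)
       (auto simp: signed_stirling_def atLeast0AtMost mult.assoc[symmetric]
                   power_add[symmetric] mult_2[symmetric] simp flip: power_mult_distrib)
  finally show ?thesis .
qed

definition B_coeff :: "nat \<Rightarrow> nat \<Rightarrow> real" where
  "B_coeff k j = (\<Sum>p=0..k-j-1. (-1) ^ (k + j + 1) * real ((j + p) choose j)
      * ((real k - 1) / 2) ^ p
      * of_int (signed_stirling k (j + p + 1) + signed_stirling (k - 1) (j + p)))"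

definition mp_term :: "nat \<Rightarrow> complex \<Rightarrow> nat \<Rightarrow> complex" where
  "mp_term k s n = of_real (P_poly k (2 * real n))
      / of_real (2 * real n * (2 * real n + real k - 1)) powr s"

(* Shifted by one because the series starts at n = 1; meaningful only for Re s > k/2. *)
definition mp_zeta :: "nat \<Rightarrow> complex \<Rightarrow> complex" where
  "mp_zeta k s = (\<Sum>n. mp_term k s (Suc n))"

end

theory Submission
  imports Defs "HOL-Real_Asymp.Real_Asymp"
begin

text \<open>
  With \<open>a = (k - 1) / 2\<close> and \<open>y = 2n + a\<close> one has \<open>2n (2n + k - 1) = y\<^sup>2 - a\<^sup>2\<close>, while
  \<open>(k - 1)! P\<^sub>k(y - a)\<close> is a polynomial in \<open>y\<close> with the parity of \<open>k - 1\<close> and without constant term,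
  hence equals \<open>\<Sum>h. B\<^bsub>k,k-2h-1\<^esub> y\<^bsup>k-2h-1\<^esup>\<close>. Expanding \<open>(y\<^sup>2 - a\<^sup>2) powr -s\<close> binomially in
  \<open>a\<^sup>2 / y\<^sup>2\<close> up to order \<open>M\<close> writes \<open>L\<^sub>k\<close> as a finite combination of shifted Hurwitz-type series
  \<open>Z(w) = \<Sum>n. y powr -w\<close> at \<open>w = 2s + 2m + 2h - k + 1\<close>, plus a series converging on a half-plane
  that grows with \<open>M\<close>. The product \<open>(w - 1) Z(w)\<close> is entire with value \<open>1/2\<close> at \<open>w = 1\<close>, so each
  term contributes a simple pole at \<open>s = k/2 - (m + h)\<close>. For even \<open>k\<close> and \<open>n \<ge> k/2\<close> the binomial
  coefficients \<open>(n - k/2) gchoose (n - h)\<close> vanish.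
\<close>

subsection \<open>Continuation from polar expansions on half-planes\<close>

text \<open>For each \<open>N\<close>, subtracting the first \<open>N\<close> candidate polar parts
  leaves a function that continues \<open>N\<close> units to the left. The equation is asked for
  only on \<open>\<sigma> < Re s\<close>, where \<open>f\<close> may be a convergent series;
  \<open>r n = 0\<close> means that the candidate is not a pole.\<close>

definition polar_expansion :: "real \<Rightarrow> (complex \<Rightarrow> complex) \<Rightarrow> (nat \<Rightarrow> complex) \<Rightarrow> bool" where
  "polar_expansion \<sigma> f r \<longleftrightarrow>
     (\<forall>N. \<exists>g. g holomorphic_on {s. \<sigma> - real N < Re s} \<and>
        (\<forall>s. \<sigma> < Re s \<longrightarrow>
           f s = (\<Sum>n<N. r n / (s - complex_of_real (\<sigma> - real n))) + g s))"

lemma polar_expansion_zero: "polar_expansion \<sigma> (\<lambda>_. 0) (\<lambda>_. 0)"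
  unfolding polar_expansion_def by (auto intro!: exI[of _ "\<lambda>_. 0"])

lemma polar_expansion_add:
  assumes "polar_expansion \<sigma> f r" "polar_expansion \<sigma> f' r'"
  shows   "polar_expansion \<sigma> (\<lambda>s. f s + f' s) (\<lambda>n. r n + r' n)"
  unfolding polar_expansion_def
proof
  fix N
  obtain g where g: "g holomorphic_on {s. \<sigma> - real N < Re s}"
      "\<And>s. \<sigma> < Re s \<Longrightarrow> f s = (\<Sum>n<N. r n / (s - of_real (\<sigma> - real n))) + g s"
    using assms(1) unfolding polar_expansion_def by meson
  obtain g' where g': "g' holomorphic_on {s. \<sigma> - real N < Re s}"
      "\<And>s. \<sigma> < Re s \<Longrightarrow> f' s = (\<Sum>n<N. r' n / (s - of_real (\<sigma> - real n))) + g' s"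
    using assms(2) unfolding polar_expansion_def by meson
  show "\<exists>G. G holomorphic_on {s. \<sigma> - real N < Re s} \<and> (\<forall>s. \<sigma> < Re s \<longrightarrow>
          f s + f' s = (\<Sum>n<N. (r n + r' n) / (s - of_real (\<sigma> - real n))) + G s)"
    by (rule exI[of _ "\<lambda>s. g s + g' s"])
       (use g g' in \<open>auto intro!: holomorphic_intros simp: add_divide_distrib sum.distrib\<close>)
qed

lemma polar_expansion_cmult:
  assumes "polar_expansion \<sigma> f r"
  shows   "polar_expansion \<sigma> (\<lambda>s. c * f s) (\<lambda>n. c * r n)"
  unfolding polar_expansion_def
proof
  fix N
  obtain g where g: "g holomorphic_on {s. \<sigma> - real N < Re s}"
      "\<And>s. \<sigma> < Re s \<Longrightarrow> f s = (\<Sum>n<N. r n / (s - of_real (\<sigma> - real n))) + g s"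
    using assms(1) unfolding polar_expansion_def by meson
  show "\<exists>G. G holomorphic_on {s. \<sigma> - real N < Re s} \<and> (\<forall>s. \<sigma> < Re s \<longrightarrow>
          c * f s = (\<Sum>n<N. c * r n / (s - of_real (\<sigma> - real n))) + G s)"
    by (rule exI[of _ "\<lambda>s. c * g s"])
       (use g in \<open>auto intro!: holomorphic_intros simp: distrib_left sum_distrib_left\<close>)
qed

lemma polar_expansion_sum:
  assumes "\<And>i. i \<in> I \<Longrightarrow> polar_expansion \<sigma> (f i) (r i)"
  shows   "polar_expansion \<sigma> (\<lambda>s. \<Sum>i\<in>I. f i s) (\<lambda>n. \<Sum>i\<in>I. r i n)"
  using assms
  by (induction I rule: infinite_finite_induct)
     (simp_all add: polar_expansion_zero polar_expansion_add)

lemma polar_expansion_cong: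
  assumes "polar_expansion \<sigma> f r" "\<And>s. \<sigma> < Re s \<Longrightarrow> f s = f' s"
  shows   "polar_expansion \<sigma> f' r"
  using assms unfolding polar_expansion_def by fastforce

section \<open>Identity theorem and local behaviour at a simple pole\<close>

lemma holomorphic_eq_on_halfplane:
  assumes f: "f holomorphic_on {s. c < Re s}" and g: "g holomorphic_on {s. c < Re s}"
    and eq: "\<And>s. d < Re s \<Longrightarrow> f s = g s" and s: "c < Re s"
  shows "f s = g s"
proof -
  \<comment> \<open>On this open nonempty set both functions are holomorphic and known to agree;
    that determines them on the connected half-plane \<open>c < Re s\<close>.\<close>
  let ?T = "{s. max c d < Re s}"
  have ne: "?T \<noteq> {}"
    by (auto intro!: exI[of _ "of_real (max c d + 1)"])
  have T: "open ?T"
    by (rule open_halfspace_Re_gt)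
  show ?thesis
    by (rule analytic_continuation_open[OF T _ ne _ _ f g])
       (use eq s in \<open>auto simp: open_halfspace_Re_gt intro!: convex_connected convex_halfspace_Re_gt\<close>)
qed

text \<open>Everything is read off \<open>f w = h w / (w - z)\<close> with
  \<open>h w = c + (w - z) * g w\<close>, so that \<open>h z = c\<close>. For \<open>c = 0\<close>
  the function agrees with \<open>g\<close> near \<open>z\<close> and has a finite limit.\<close>

lemma simple_polar_part:
  assumes g: "g holomorphic_on S" and S: "open S" "z \<in> S"
    and f: "\<And>w. w \<in> S \<Longrightarrow> w \<noteq> z \<Longrightarrow> f w = c / (w - z) + g w"
  shows "isolated_singularity_at f z" "not_essential f z" "residue f z = c"
        "is_pole f z \<longleftrightarrow> c \<noteq> 0" "c \<noteq> 0 \<Longrightarrow> zorder f z = -1"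
proof -
  define h where "h = (\<lambda>w. c + (w - z) * g w)"
  have h: "h holomorphic_on S"
    unfolding h_def by (intro holomorphic_intros g)
  have fh: "f w = h w / (w - z)" if "w \<in> S" "w \<noteq> z" for w
    using f[OF that] that by (simp add: h_def field_simps)
  have ev: "eventually (\<lambda>w. f w = h w / (w - z)) (at z)"
    using S fh by (auto simp: eventually_at_topological)
  have evg: "eventually (\<lambda>w. f w = c / (w - z) + g w) (at z)"
    using S f by (auto simp: eventually_at_topological)
  have mer: "(\<lambda>w. h w / (w - z)) meromorphic_on {z}"
    using h S by (intro meromorphic_intros analytic_on_imp_meromorphic_on)
      (auto simp: analytic_on_open analytic_at intro: analytic_on_subset)
  have "f meromorphic_on {z}"
    using mer ev by (subst meromorphic_on_cong[where g = "\<lambda>w. h w / (w - z)"]) auto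
  thus "isolated_singularity_at f z" "not_essential f z"
    by (auto simp: meromorphic_at_iff)
  show "residue f z = c"
    using residue_cong[OF ev refl] residue_simple[OF S h] by (simp add: h_def)
  have pole: "is_pole f z" "zorder f z = -1" if "c \<noteq> 0"
  proof -
    have "is_pole (\<lambda>w. h w / (w - z) ^ 1) z"
      by (rule is_pole_basic[OF h]) (use S that in \<open>auto simp: h_def\<close>)
    thus "is_pole f z"
      using is_pole_cong[OF ev refl] by simp
    show "zorder f z = -1"
      by (rule zorder_eqI[OF S h])
         (use that in \<open>auto simp: h_def fh power_int_minus field_simps\<close>)
  qed
  have "\<not> is_pole f z" if "c = 0"
  proof -
    have "f \<midarrow>z\<rightarrow> g z"
    proof (rule Lim_transform_eventually)
      show "g \<midarrow>z\<rightarrow> g z"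
        using g S by (meson continuous_on_eq_continuous_at holomorphic_on_imp_continuous_on isCont_def)
      show "eventually (\<lambda>w. g w = f w) (at z)"
        using evg by eventually_elim (use that in simp)
    qed
    thus ?thesis
      by (meson at_neq_bot is_pole_def not_tendsto_and_filterlim_at_infinity)
  qed
  thus "is_pole f z \<longleftrightarrow> c \<noteq> 0" "c \<noteq> 0 \<Longrightarrow> zorder f z = -1"
    using pole by auto
qed

text \<open>
  The expansions for different \<open>N\<close> agree by the identity theorem and glue to a function on the
  plane; \<open>remove_sings\<close> then fills in the points where the residue vanishes. At \<open>s = p n\<close> the term
  \<open>r n / (s - p n)\<close> is 0 by convention, so no exceptional set is needed while gluing.
\<close>
theorem polar_expansion_continuation:
  assumes "polar_expansion \<sigma> f r"
  obtains L where "L nicely_meromorphic_on UNIV"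
    "\<And>s. \<sigma> < Re s \<Longrightarrow> L s = f s"
    "\<And>z. is_pole L z \<Longrightarrow> zorder L z = -1 \<and> (\<exists>n. z = complex_of_real (\<sigma> - real n) \<and> r n \<noteq> 0)"
    "\<And>n. residue L (complex_of_real (\<sigma> - real n)) = r n"
proof -
  define p where "p = (\<lambda>n. complex_of_real (\<sigma> - real n))"
  define D where "D = (\<lambda>N. {s. \<sigma> - real N < Re s})"
  obtain g where g: "\<And>N. g N holomorphic_on D N"
      and fg: "\<And>N s. \<sigma> < Re s \<Longrightarrow> f s = (\<Sum>n<N. r n / (s - p n)) + g N s"
    using assms unfolding polar_expansion_def D_def p_def by metis
  define F where "F = (\<lambda>N s. (\<Sum>n<N. r n / (s - p n)) + g N s)"
  have openD: "open (D N)" for N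
    by (simp add: D_def open_halfspace_Re_gt)
  have D_mono: "D M \<subseteq> D N" if "M \<le> N" for M N
    using that by (auto simp: D_def)
  have p_notin: "p N \<notin> D N" for N
    by (simp add: D_def p_def)
  have F_Suc: "F (Suc N) s = F N s" if "s \<in> D N" for N s
  proof -
    \<comment> \<open>Both sides are holomorphic on \<open>D N\<close>, because \<open>p N\<close>
      lies on its boundary line, and for \<open>\<sigma> < Re s\<close> both equal \<open>f\<close>
      minus the first \<open>N\<close> polar terms.\<close>
    have "g N s = r N / (s - p N) + g (Suc N) s"
    proof (rule holomorphic_eq_on_halfplane[where f = "g N" and
          g = "\<lambda>s. r N / (s - p N) + g (Suc N) s" and c = "\<sigma> - real N" and d = \<sigma>])
      show "g N holomorphic_on {s. \<sigma> - real N < Re s}"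
        using g[of N] by (simp add: D_def)
      have "(\<lambda>s. r N / (s - p N) + g (Suc N) s) holomorphic_on D N"
        using p_notin D_mono[of N "Suc N"]
        by (intro holomorphic_intros holomorphic_on_subset[OF g]) auto
      thus "(\<lambda>s. r N / (s - p N) + g (Suc N) s) holomorphic_on {s. \<sigma> - real N < Re s}"
        by (simp add: D_def)
      show "g N s = r N / (s - p N) + g (Suc N) s" if "\<sigma> < Re s" for s
        using fg[OF that, of N] fg[OF that, of "Suc N"] by simp
      show "\<sigma> - real N < Re s"
        using \<open>s \<in> D N\<close> by (simp add: D_def)
    qed
    thus ?thesis by (simp add: F_def)
  qed
  have F_mono: "F M s = F N s" if "N \<le> M" "s \<in> D N" for M N s
    using that
  proof (induction M rule: dec_induct)
    case (step M)
    thus ?case using F_Suc[of s M] D_mono[of N M] by auto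
  qed auto
  \<comment> \<open>The \<open>+ 1\<close> makes the index exceed \<open>\<sigma> - Re s\<close>
    strictly, which puts \<open>s\<close> into the open half-plane \<open>D\<close> of that index;
    by \<open>F_mono\<close> every other admissible index gives the same value.\<close>
  define L0 where "L0 = (\<lambda>s. F (nat \<lceil>\<sigma> - Re s\<rceil> + 1) s)"
  have in_D: "s \<in> D (nat \<lceil>\<sigma> - Re s\<rceil> + 1)" for s
    unfolding D_def by (simp add: algebra_simps) linarith
  have L0: "L0 s = F N s" if "s \<in> D N" for s N
    using F_mono[OF _ in_D, of s] F_mono[OF _ that] unfolding L0_def
    by (metis nat_le_linear that in_D)
  have p_inj: "p m = p n \<longleftrightarrow> m = n" for m n
    by (simp add: p_def)
  have loc: "\<exists>c S g'. g' holomorphic_on S \<and> open S \<and> z \<in> S \<and>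
      (\<forall>w\<in>S. w \<noteq> z \<longrightarrow> L0 w = c / (w - z) + g' w) \<and>
      (c \<noteq> 0 \<longrightarrow> (\<exists>n. z = p n \<and> r n \<noteq> 0)) \<and> (\<forall>n. z = p n \<longrightarrow> c = r n)" for z
  proof -
    define N where "N = nat \<lceil>\<sigma> - Re z\<rceil> + 1"
    have zD: "z \<in> D N" unfolding N_def by (rule in_D)
    have pN: "n < N" if "z = p n" for n
      using zD that by (auto simp: D_def p_def)
    \<comment> \<open>\<open>S\<close> omits the candidate poles other than \<open>z\<close>; those
      of index at least \<open>N\<close> lie outside \<open>D N\<close>. As \<open>p\<close> is
      injective, at most one summand of \<open>c\<close> below is nonzero.\<close>
    define S where "S = D N - (p ` {..<N} - {z})"
    define c where "c = (\<Sum>n<N. if z = p n then r n else 0)"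
    define g' where "g' = (\<lambda>w. (\<Sum>n<N. if z = p n then 0 else r n / (w - p n)) + g N w)"
    have g': "g' holomorphic_on S"
      unfolding g'_def
    proof (intro holomorphic_intros)
      show "g N holomorphic_on S"
        by (rule holomorphic_on_subset[OF g]) (auto simp: S_def)
      show "(\<lambda>w. if z = p n then 0 else r n / (w - p n)) holomorphic_on S" if "n \<in> {..<N}" for n
        using that by (cases "z = p n") (auto simp: S_def intro!: holomorphic_intros)
    qed
    moreover have "open S"
      unfolding S_def by (intro open_Diff openD finite_imp_closed finite_Diff finite_imageI) auto
    moreover have "z \<in> S"
      using zD by (auto simp: S_def)
    moreover have "L0 w = c / (w - z) + g' w" if "w \<in> S" "w \<noteq> z" for w
    proof -
      have "L0 w = F N w" using that by (intro L0) (auto simp: S_def)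
      also have "(\<Sum>n<N. r n / (w - p n)) = (\<Sum>n<N. (if z = p n then r n else 0) / (w - z) +
                   (if z = p n then 0 else r n / (w - p n)))"
        by (intro sum.cong) auto
      hence "F N w = c / (w - z) + g' w"
        by (simp add: F_def c_def g'_def sum.distrib sum_divide_distrib)
      finally show ?thesis .
    qed
    moreover have c: "c = r n" if "z = p n" for n
      unfolding c_def using that pN[OF that] by (simp add: p_inj)
    moreover have "\<exists>n. z = p n \<and> r n \<noteq> 0" if "c \<noteq> 0"
    proof -
      have "\<exists>n. z = p n"
      proof (rule ccontr)
        assume "\<not> ?thesis"
        hence "c = 0" by (simp add: c_def)
        with that show False by simp
      qed
      with c that show ?thesis by auto
    qed
    ultimately show ?thesis
      by (intro exI[of _ c] exI[of _ S] exI[of _ g']) blast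
  qed
  have iso: "isolated_singularity_at L0 z" and ess: "not_essential L0 z" for z
    using loc[of z] simple_polar_part(1,2)[of _ _ z L0] by metis+
  have pole: "zorder L0 z = -1 \<and> (\<exists>n. z = p n \<and> r n \<noteq> 0)" if "is_pole L0 z" for z
    using loc[of z] simple_polar_part(4,5)[of _ _ z L0] that by metis
  have res: "residue L0 (p n) = r n" for n
    using loc[of "p n"] simple_polar_part(3)[of _ _ "p n" L0] by metis
  show ?thesis
  proof (rule that[of "remove_sings L0"])
    show "remove_sings L0 nicely_meromorphic_on UNIV"
      by (rule remove_sings_nicely_meromorphic) (auto simp: meromorphic_on_altdef iso ess)
    show "remove_sings L0 s = f s" if "\<sigma> < Re s" for s
    proof -
      \<comment> \<open>On \<open>D 0\<close> the sum of polar terms is empty, so \<open>L0\<close>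
        is \<open>g 0\<close> and filling in singularities changes nothing.\<close>
      have "L0 analytic_on D 0"
      proof -
        have "g 0 holomorphic_on D 0" by (rule g)
        also have "?this \<longleftrightarrow> L0 holomorphic_on D 0"
          by (intro holomorphic_cong) (auto simp: L0[of _ 0] F_def)
        finally show ?thesis by (simp add: analytic_on_open openD)
      qed
      moreover have "s \<in> D 0" using that by (simp add: D_def)
      ultimately have "remove_sings L0 s = L0 s"
        by (intro remove_sings_at_analytic) (auto intro: analytic_on_subset)
      also have "\<dots> = f s"
        using L0[OF \<open>s \<in> D 0\<close>] fg[OF that, of 0] by (simp add: F_def)
      finally show ?thesis .
    qed
  qed (use pole res iso in \<open>auto simp: p_def\<close>)
qed

text \<open>The case of \<open>polar_expansion_continuation\<close> with all residues 0: a nicely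
  meromorphic function without poles is entire.\<close>

lemma entire_extension:
  assumes "\<And>N::nat. \<exists>g. g holomorphic_on {s. \<sigma> - real N < Re s} \<and> (\<forall>s. \<sigma> < Re s \<longrightarrow> g s = f s)"
  obtains H where "H holomorphic_on UNIV" "\<And>s. \<sigma> < Re s \<Longrightarrow> H s = f s"
proof -
  have "polar_expansion \<sigma> f (\<lambda>_. 0)"
    unfolding polar_expansion_def using assms by simp metis
  then obtain L where L: "L nicely_meromorphic_on UNIV" "\<And>s. \<sigma> < Re s \<Longrightarrow> L s = f s"
    "\<And>z. \<not> is_pole L z"
    by (rule polar_expansion_continuation) blast
  have "L holomorphic_on UNIV"
    using nicely_meromorphic_without_singularities[OF L(1)] L(3)
    by (simp add: analytic_imp_holomorphic)
  with L(2) show ?thesis using that by blast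
qed

text \<open>The difference quotient of \<open>\<phi>\<close> at \<open>p\<close>, completed by the
  derivative, is entire and serves as \<open>\<psi>\<close>.\<close>

lemma polar_part_entire_quotient:
  assumes "\<phi> holomorphic_on UNIV"
  obtains \<psi> where "\<psi> holomorphic_on UNIV" "\<And>s. s \<noteq> p \<Longrightarrow> \<phi> s / (s - p) = \<phi> p / (s - p) + \<psi> s"
proof (rule that)
  show "(\<lambda>s. if s = p then deriv \<phi> p else (\<phi> s - \<phi> p) / (s - p)) holomorphic_on UNIV"
    by (rule pole_lemma_open[OF assms]) auto
qed (auto simp: diff_divide_distrib)

subsection \<open>The Hurwitz-type series\<close>

text \<open>The bound is the coefficient of the majorant \<open>(1 - x) powr (- norm z)\<close>, with real exponent.\<close>
lemma norm_gbinomial_le: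
  fixes z :: complex
  shows "norm (z gchoose m) \<le> (-1) ^ m * ((- norm z) gchoose m)"
proof -
  have "norm (z gchoose m) = (\<Prod>i=0..<m. norm (z - of_nat i)) / fact m"
    by (simp add: gbinomial_prod_rev norm_divide prod_norm)
  also have "\<dots> \<le> (\<Prod>i=0..<m. norm z + real i) / fact m"
    by (intro divide_right_mono prod_mono) (auto intro: order.trans[OF norm_triangle_ineq4])
  also have "(\<Prod>i=0..<m. norm z + real i) = (\<Prod>i=0..<m. (-1) * (- norm z - real i))"
    by (intro prod.cong) auto
  also have "\<dots> / fact m = (-1) ^ m * ((- norm z) gchoose m)"
    by (subst prod.distrib) (simp add: gbinomial_prod_rev)
  finally show ?thesis .
qed

text \<open>Since \<open>norm u \<le> \<rho>\<close>, each tail term yields a factor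
  \<open>(norm u / \<rho>) ^ M\<close>, and what is left is majorised by the series of
  \<open>(1 - \<rho>) powr (- norm z)\<close>. The bound sees \<open>z\<close> only through
  \<open>norm z\<close>, so it is locally uniform in \<open>z\<close>.\<close>

lemma binomial_series_remainder:
  fixes z u :: complex
  assumes \<rho>: "0 < \<rho>" "\<rho> < 1" and u: "norm u \<le> \<rho>"
  shows "norm ((1 + u) powr z - (\<Sum>m<M. (z gchoose m) * u ^ m))
           \<le> (norm u / \<rho>) ^ M * (1 - \<rho>) powr (- norm z)"
proof -
  define c where "c = (\<lambda>m. (-1) ^ m * ((- norm z) gchoose m) * \<rho> ^ m)"
  have c_sums: "c sums ((1 - \<rho>) powr (- norm z))"
    using gen_binomial_real[of "-\<rho>" "- norm z"] \<rho>
    by (simp add: c_def power_minus[of \<rho>] mult_ac)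
  have c_ge: "norm (z gchoose m) * \<rho> ^ m \<le> c m" for m
    unfolding c_def using \<rho> by (intro mult_right_mono norm_gbinomial_le) auto
  have c_nonneg: "0 \<le> c m" for m
    using \<rho> by (intro order.trans[OF _ c_ge]) auto
  have le: "norm ((z gchoose (m + M)) * u ^ (m + M)) \<le> (norm u / \<rho>) ^ M * c (m + M)" for m
  proof -
    have "norm ((z gchoose (m + M)) * u ^ (m + M)) =
            (norm u / \<rho>) ^ (m + M) * (norm (z gchoose (m + M)) * \<rho> ^ (m + M))"
      using \<rho> by (simp add: norm_mult norm_power power_divide)
    also have "\<dots> \<le> (norm u / \<rho>) ^ M * c (m + M)"
      using \<rho> u by (intro mult_mono c_ge power_decreasing) auto
    finally show ?thesis .
  qed
  have sums: "(\<lambda>m. (z gchoose m) * u ^ m) sums (1 + u) powr z"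
    using u \<rho> by (intro gen_binomial_complex) auto
  have sc: "summable (\<lambda>m. (norm u / \<rho>) ^ M * c (m + M))"
    using c_sums by (intro summable_mult) (simp add: sums_iff)
  have sum1: "(1 + u) powr z - (\<Sum>m<M. (z gchoose m) * u ^ m) =
          (\<Sum>m. (z gchoose (m + M)) * u ^ (m + M))"
    using sums suminf_split_initial_segment[of "\<lambda>m. (z gchoose m) * u ^ m" M]
    by (simp add: sums_iff)
  have "norm (\<Sum>m. (z gchoose (m + M)) * u ^ (m + M)) \<le> (\<Sum>m. (norm u / \<rho>) ^ M * c (m + M))"
    by (rule norm_suminf_le[OF le sc])
  also have "\<dots> = (norm u / \<rho>) ^ M * (\<Sum>m. c (m + M))"
    using c_sums by (intro suminf_mult) (simp add: sums_iff)
  also have "\<dots> \<le> (norm u / \<rho>) ^ M * (1 - \<rho>) powr (- norm z)"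
  proof (intro mult_left_mono)
    have "(\<Sum>m. c (m + M)) \<le> (\<Sum>m. c m)"
      using suminf_split_initial_segment[of c M] c_sums sum_nonneg[of "{..<M}" c] c_nonneg
      by (simp add: sums_iff)
    thus "(\<Sum>m. c (m + M)) \<le> (1 - \<rho>) powr (- norm z)"
      using c_sums by (simp add: sums_iff)
  qed (use \<rho> in auto)
  finally show ?thesis by (simp add: sum1)
qed

section \<open>Holomorphic sums of Dirichlet type\<close>

text \<open>The factor \<open>B\<close> is bounded on bounded sets and the powers decay uniformly
  near each point of the half-plane, so a summable majorant exists locally and the series may be
  differentiated termwise.\<close>

lemma
  fixes F :: "nat \<Rightarrow> complex \<Rightarrow> complex"
  assumes hol: "\<And>n. F n holomorphic_on UNIV" and q: "q > 0"
    and y: "\<And>n. y n \<ge> real (Suc n)"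
    and B: "mono B" "\<And>x. B x \<ge> 0"
    and bound: "\<And>n s. norm (F n s) \<le> B (norm s) * y n powr (-(q * Re s + b))"
  shows holomorphic_dirichlet_sum: "(\<lambda>s. \<Sum>n. F n s) holomorphic_on {s. q * Re s + b > 1}"
    and summable_dirichlet_sum: "q * Re s + b > 1 \<Longrightarrow> summable (\<lambda>n. F n s)"
proof -
  define S where "S = {s::complex. q * Re s + b > 1}"
  have S: "open S"
  proof -
    have "S = {s. Re s > (1 - b) / q}"
      using q by (auto simp: S_def field_simps)
    thus ?thesis by (simp add: open_halfspace_Re_gt)
  qed
  have dom: "\<exists>d h. 0 < d \<and> summable h \<and> range h \<subseteq> \<real>\<^sub>\<ge>\<^sub>0 \<and>
          (\<forall>\<^sub>F n in sequentially. \<forall>w\<in>ball x d \<inter> S. norm (F n w) \<le> norm (h n :: complex))"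
    if x: "x \<in> S" for x
  proof -
    \<comment> \<open>\<open>e\<close> is the midpoint of 1 and \<open>q * Re x + b\<close>; the
      radius \<open>d\<close> is such that the exponent cannot fall below \<open>e\<close> on the
      ball.\<close>
    define e where "e = (q * Re x + b + 1) / 2"
    define d where "d = (q * Re x + b - 1) / (2 * q)"
    have d: "d > 0" and e: "e > 1"
      using x q by (auto simp: S_def d_def e_def)
    define h where "h = (\<lambda>n. B (norm x + d) * real (Suc n) powr (-e))"
    have "summable (\<lambda>n. real (Suc n) powr (-e))"
      using summable_real_powr_iff[of "-e"] e summable_Suc_iff[of "\<lambda>n. real n powr (-e)"] by simp
    hence "summable h"
      unfolding h_def by (rule summable_mult)
    moreover have "norm (F n w) \<le> h n" if "w \<in> ball x d" for n w
    proof -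
      have "norm w \<le> norm x + norm (w - x)"
        by (metis add.commute diff_add_cancel norm_triangle_ineq)
      hence 1: "B (norm w) \<le> B (norm x + d)"
        using that by (intro monoD[OF B(1)]) (auto simp: dist_norm norm_minus_commute)
      have "Re x - Re w \<le> norm (x - w)"
        using complex_Re_le_cmod[of "x - w"] by simp
      hence "q * (Re x - Re w) \<le> q * d"
        using that q by (intro mult_left_mono) (auto simp: dist_norm)
      also have "q * d = (q * Re x + b - 1) / 2"
        using q by (simp add: d_def)
      finally have 2: "q * Re w + b \<ge> e"
        by (simp add: e_def field_simps)
      have "norm (F n w) \<le> B (norm w) * y n powr (-(q * Re w + b))"
        by (rule bound)
      also have "\<dots> \<le> B (norm x + d) * y n powr (-e)"
        using 1 2 B(2) y[of n] by (intro mult_mono powr_mono) auto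
      also have "y n powr (-e) \<le> real (Suc n) powr (-e)"
        using e y[of n] by (intro powr_mono2') auto
      finally show ?thesis
        using B(2) by (simp add: h_def mult_left_mono)
    qed
    moreover have "h n \<ge> 0" for n
      using B(2) by (simp add: h_def)
    ultimately show ?thesis
      by (intro exI[of _ d] exI[of _ "\<lambda>n. of_real (h n)"] conjI d always_eventually)
         (auto simp: summable_of_real)
  qed
  have der: "(F n has_field_derivative deriv (F n) x) (at x)" for n x
    using hol[of n] by (intro holomorphic_derivI[where S = UNIV]) auto
  obtain g g' where g: "\<forall>x\<in>S. ((\<lambda>n. F n x) sums g x) \<and> ((\<lambda>n. deriv (F n) x) sums g' x) \<and>
                          (g has_field_derivative g' x) (at x)"
    using series_and_derivative_comparison_complex[OF S der dom] by blast
  have "g holomorphic_on S"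
    using g by (auto simp: holomorphic_on_open[OF S])
  also have "?this \<longleftrightarrow> (\<lambda>s. \<Sum>n. F n s) holomorphic_on S"
    using g by (intro holomorphic_cong) (auto simp: sums_iff)
  finally show "(\<lambda>s. \<Sum>n. F n s) holomorphic_on {s. q * Re s + b > 1}"
    by (simp add: S_def)
  show "summable (\<lambda>n. F n s)" if "q * Re s + b > 1"
    using g that by (auto simp: S_def sums_iff)
qed

lemma holomorphic_on_gbinomial [holomorphic_intros]:
  "f holomorphic_on A \<Longrightarrow> (\<lambda>s. f s gchoose m) holomorphic_on A"
  unfolding gbinomial_prod_rev by (intro holomorphic_intros) auto

section \<open>Continuation of a shifted Hurwitz zeta function\<close>

definition node :: "real \<Rightarrow> nat \<Rightarrow> real" where
  "node a n = 2 * real (Suc n) + a"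

text \<open>For \<open>a \<ge> 0\<close> and \<open>Re w > 1\<close> this is
  \<open>2 powr (-w)\<close> times the Hurwitz zeta function at \<open>w\<close> with parameter
  \<open>1 + a / 2\<close>.\<close>

definition node_zeta :: "real \<Rightarrow> complex \<Rightarrow> complex" where
  "node_zeta a w = (\<Sum>n. of_real (node a n) powr (-w))"

lemma node_ge: "a \<ge> 0 \<Longrightarrow> node a n \<ge> real (Suc n)" "a \<ge> 0 \<Longrightarrow> node a n \<ge> 2 + a"
  by (auto simp: node_def)

lemma norm_of_real_powr:
  "y > 0 \<Longrightarrow> norm (complex_of_real y powr w) = y powr Re w"
  by (simp add: norm_powr_real_powr)

lemma
  assumes a: "a \<ge> 0"
  shows holomorphic_node_zeta: "node_zeta a holomorphic_on {w. Re w > 1}"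
    and summable_node_zeta: "Re w > 1 \<Longrightarrow> summable (\<lambda>n. complex_of_real (node a n) powr (-w))"
proof -
  have hol: "(\<lambda>w. complex_of_real (node a n) powr (-w)) holomorphic_on UNIV" for n
    by (intro holomorphic_intros)
  have y: "node a n \<ge> real (Suc n)" for n
    by (rule node_ge(1)[OF a])
  have bound: "norm (complex_of_real (node a n) powr (-w)) \<le> 1 * node a n powr (-(1 * Re w + 0))" for n w
    using node_ge(2)[OF a, of n] a by (simp add: norm_of_real_powr)
  have B: "mono (\<lambda>_::real. 1::real)" "\<And>x::real. (0::real) \<le> 1"
    by (auto simp: mono_def)
  from holomorphic_dirichlet_sum[OF hol zero_less_one y B bound]
  show "node_zeta a holomorphic_on {w. Re w > 1}"
    by (simp add: node_zeta_def [abs_def])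
  from summable_dirichlet_sum[OF hol zero_less_one y B bound, of w]
  show "Re w > 1 \<Longrightarrow> summable (\<lambda>n. complex_of_real (node a n) powr (-w))"
    by simp
qed

text \<open>The central difference of \<open>y powr (1 - w)\<close> minus the first \<open>M\<close>
  terms of its expansion in \<open>1 / y\<close>; only odd binomial terms survive the
  difference.\<close>

definition telescope_remainder :: "nat \<Rightarrow> real \<Rightarrow> complex \<Rightarrow> complex" where
  "telescope_remainder M y w = of_real (y + 1) powr (1 - w) - of_real (y - 1) powr (1 - w)
     - 2 * (\<Sum>i<M. ((1 - w) gchoose (2 * i + 1)) * of_real y powr (-(w + 2 * of_nat i)))"

lemma sum_odd_part:
  fixes c :: "nat \<Rightarrow> 'a :: comm_ring_1"
  shows "(\<Sum>m<2*M+1. c m * u ^ m) - (\<Sum>m<2*M+1. c m * (-u) ^ m) =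
           2 * (\<Sum>i<M. c (2*i+1) * u ^ (2*i+1))"
  by (induction M) (simp_all add: algebra_simps)

text \<open>Factoring out \<open>y powr (1 - w)\<close> leaves binomial remainders at
  \<open>1 / y\<close> and \<open>- 1 / y\<close>, both of norm at most 1/2 as
  \<open>y \<ge> 2\<close>. Expanding both through degree \<open>2 * M\<close> leaves an error with
  a factor \<open>y ^ (2 * M + 1)\<close> in the denominator.\<close>

lemma norm_telescope_remainder_le:
  assumes y: "y \<ge> 2"
  shows "norm (telescope_remainder M y w) \<le>
           2 * 2 ^ (2*M+1) * 2 powr (1 + norm w) * y powr (-(1 * Re w + 2 * real M))"
proof -
  define z where "z = 1 - w"
  define u where "u = complex_of_real (1 / y)"
  define T where "T = (\<lambda>u. (1 + u) powr z - (\<Sum>m<2*M+1. (z gchoose m) * u ^ m))"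
  have split: "of_real (y + t) powr z = of_real y powr z * (1 + of_real (t / y)) powr z"
    if "\<bar>t\<bar> \<le> 1" for t
  proof -
    have "complex_of_real (y + t) = of_real y * of_real (1 + t / y)"
      using y by (simp add: field_simps flip: of_real_mult of_real_add)
    also have "\<dots> powr z = of_real y powr z * of_real (1 + t / y) powr z"
      using y that by (intro powr_times_real) (auto simp: field_simps)
    finally show ?thesis by simp
  qed
  have pow: "of_real y powr (-(w + 2 * of_nat i)) = of_real y powr z * u ^ (2*i+1)" for i
  proof -
    have "-(w + 2 * of_nat i) = z - of_nat (2*i+1)"
      by (simp add: z_def)
    also have "of_real y powr \<dots> = of_real y powr z / of_real y ^ (2*i+1)"
      using y powr_complexpow[of "complex_of_real y" "2*i+1"]
      by (subst powr_diff) (simp del: powr_complexpow)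
    finally show ?thesis
      by (simp add: u_def power_divide)
  qed
  have "2 * (\<Sum>i<M. (z gchoose (2*i+1)) * of_real y powr (-(w + 2 * of_nat i))) =
          of_real y powr z * (2 * (\<Sum>i<M. (z gchoose (2*i+1)) * u ^ (2*i+1)))"
    by (simp only: pow) (simp only: sum_distrib_left mult_ac)
  also have "2 * (\<Sum>i<M. (z gchoose (2*i+1)) * u ^ (2*i+1)) =
       (\<Sum>m<2*M+1. (z gchoose m) * u ^ m) - (\<Sum>m<2*M+1. (z gchoose m) * (-u) ^ m)"
    by (rule sum_odd_part [symmetric])
  finally have "telescope_remainder M y w = of_real y powr z * (T u - T (-u))"
    using split[of 1] split[of "-1"]
    unfolding telescope_remainder_def z_def [symmetric] T_def
    by (simp add: u_def algebra_simps)
  also have "norm \<dots> \<le> y powr Re z * (norm (T u) + norm (T (-u)))"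
    using y by (simp add: norm_mult norm_of_real_powr mult_left_mono norm_triangle_ineq4)
  also have "norm (T v) \<le> (2 / y) ^ (2*M+1) * (1/2) powr (- norm z)" if "norm v = 1 / y" for v
    unfolding T_def
    using binomial_series_remainder[of "1/2" v z "2*M+1"] y that
    by (simp add: field_simps)
  hence "y powr Re z * (norm (T u) + norm (T (-u))) \<le>
           y powr Re z * ((2 / y) ^ (2*M+1) * (1/2) powr (- norm z) + (2 / y) ^ (2*M+1) * (1/2) powr (- norm z))"
    using y by (intro mult_left_mono add_mono) (auto simp: u_def norm_divide)
  also have "\<dots> = 2 * 2 ^ (2*M+1) * (1/2) powr (- norm z) * (y powr Re z / y ^ (2*M+1))"
    by (simp add: power_divide)
  also have "y powr Re z / y ^ (2*M+1) = y powr (Re z - real (2*M+1))"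
    using y by (subst powr_diff, subst powr_realpow) auto
  also have "Re z - real (2*M+1) = -(1 * Re w + 2 * real M)"
    by (simp add: z_def)
  also have "(1/2) powr (- norm z) = 2 powr (norm z)"
    by (simp add: powr_minus powr_divide)
  \<comment> \<open>Replacing \<open>norm (1 - w)\<close> by \<open>1 + norm w\<close> gives a
    factor monotone in \<open>norm w\<close>, the form that \<open>holomorphic_dirichlet_sum\<close>
    asks for.\<close>
  also have "2 * 2 ^ (2*M+1) * 2 powr (norm z) * y powr (-(1 * Re w + 2 * real M)) \<le>
             2 * 2 ^ (2*M+1) * 2 powr (1 + norm w) * y powr (-(1 * Re w + 2 * real M))"
    using norm_triangle_ineq4[of 1 w]
    by (intro mult_right_mono mult_left_mono powr_mono) (auto simp: z_def)
  finally show ?thesis by simp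
qed

lemma holomorphic_telescope_remainder_sum:
  assumes a: "a \<ge> 0"
  shows "(\<lambda>w. \<Sum>n. telescope_remainder M (node a n) w) holomorphic_on {w. 1 - 2 * real M < Re w}"
proof -
  have hol: "(\<lambda>w. telescope_remainder M (node a n) w) holomorphic_on UNIV" for n
    unfolding telescope_remainder_def by (intro holomorphic_intros)
  have bound: "norm (telescope_remainder M (node a n) w) \<le>
      2 * 2 ^ (2*M+1) * 2 powr (1 + norm w) * node a n powr (-(1 * Re w + 2 * real M))" for n w
    using a by (intro norm_telescope_remainder_le) (auto simp: node_def)
  have B: "mono (\<lambda>x::real. 2 * 2 ^ (2*M+1) * 2 powr (1 + x) :: real)"
    by (auto simp: mono_def)
  have B0: "0 \<le> 2 * 2 ^ (2*M+1) * 2 powr (1 + x)" for x :: real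
    by simp
  have y: "node a n \<ge> real (Suc n)" for n
    by (rule node_ge(1)[OF a])
  from holomorphic_dirichlet_sum[OF hol zero_less_one y B B0 bound]
  show "(\<lambda>w. \<Sum>n. telescope_remainder M (node a n) w) holomorphic_on {w. 1 - 2 * real M < Re w}"
    by (simp add: algebra_simps)
qed

text \<open>
  Sum \<open>(y + 1) powr (1 - w) - (y - 1) powr (1 - w)\<close> over the nodes, which have spacing 2: the left-hand
  side telescopes, and the leading term of the binomial expansion in \<open>1 / y\<close> is
  \<open>2 (1 - w) y powr -w\<close>.
\<close>
lemma node_zeta_recurrence:
  assumes a: "a \<ge> 0" and w: "Re w > 1" and M: "M \<ge> 1"
  shows "(w - 1) * node_zeta a w = of_real (1 + a) powr (1 - w) / 2
           + (\<Sum>i=1..<M. ((1 - w) gchoose (2 * i + 1)) * node_zeta a (w + 2 * of_nat i))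
           + (\<Sum>n. telescope_remainder M (node a n) w) / 2"
proof -
  \<comment> \<open>\<open>t n\<close> and \<open>t (Suc n)\<close> are the node minus 1 and plus 1,
    so neighbouring nodes share an endpoint.\<close>
  define t where "t = (\<lambda>n. 2 * real n + 1 + a)"
  have "(\<lambda>n. complex_of_real (t n) powr (1 - w)) \<longlonglongrightarrow> 0"
  proof (rule tendsto_neg_powr_complex_of_real)
    show "filterlim t at_top sequentially"
      unfolding t_def by real_asymp
  qed (use w in auto)
  hence "(\<lambda>n. complex_of_real (t (Suc n)) powr (1 - w) - of_real (t n) powr (1 - w))
           sums (0 - of_real (t 0) powr (1 - w))"
    by (rule telescope_sums)
  hence tele: "(\<lambda>n. complex_of_real (node a n + 1) powr (1 - w) - of_real (node a n - 1) powr (1 - w))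
           sums (- (of_real (1 + a) powr (1 - w)))"
    by (simp add: t_def node_def algebra_simps)
  have Z: "(\<lambda>n. of_real (node a n) powr (-(w + 2 * of_nat i))) sums node_zeta a (w + 2 * of_nat i)" for i
    unfolding node_zeta_def using a w by (intro summable_sums summable_node_zeta) auto
  have "(\<lambda>n. telescope_remainder M (node a n) w) sums (- (of_real (1 + a) powr (1 - w))
          - 2 * (\<Sum>i<M. ((1 - w) gchoose (2 * i + 1)) * node_zeta a (w + 2 * of_nat i)))"
    unfolding telescope_remainder_def
    by (intro sums_diff tele sums_mult sums_sum Z)
  hence "(\<Sum>n. telescope_remainder M (node a n) w) = - (of_real (1 + a) powr (1 - w))
          - 2 * (\<Sum>i<M. ((1 - w) gchoose (2 * i + 1)) * node_zeta a (w + 2 * of_nat i))"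
    by (simp add: sums_iff)
  \<comment> \<open>The term \<open>i = 0\<close> is \<open>(1 - w) * node_zeta a w\<close>; solving
    for it gives the left-hand side of the claim.\<close>
  also have "{..<M} = insert 0 {1..<M}"
    using M by auto
  finally show ?thesis
    by (simp add: field_simps)
qed

text \<open>The recurrence expresses \<open>(w - 1) * node_zeta a w\<close> through arguments
  shifted right by at least 2, so the claim for \<open>N\<close> yields the one for
  \<open>Suc N\<close>; with \<open>M = Suc N\<close> the remainder sum is holomorphic on the larger
  half-plane.\<close>

lemma node_zeta_partial_extension:
  assumes a: "a \<ge> 0"
  shows "\<exists>g. g holomorphic_on {s. 1 - real N < Re s} \<and>
             (\<forall>s. 1 < Re s \<longrightarrow> g s = (s - 1) * node_zeta a s)"
proof (induction N)
  case 0
  have "(\<lambda>s. (s - 1) * node_zeta a s) holomorphic_on {s. 1 < Re s}"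
    by (intro holomorphic_intros holomorphic_node_zeta a)
  thus ?case by auto
next
  case (Suc N)
  then obtain g where g: "g holomorphic_on {s. 1 - real N < Re s}"
     "\<And>s. 1 < Re s \<Longrightarrow> g s = (s - 1) * node_zeta a s" by auto
  define M where "M = Suc N"
  \<comment> \<open>The factor \<open>1 - s - 2i\<close> of \<open>(1 - s) gchoose (2i + 1)\<close> cancels the pole of \<open>node_zeta a (s + 2i)\<close>.\<close>
  define G where "G = (\<lambda>s. of_real (1 + a) powr (1 - s) / 2
    + (\<Sum>i=1..<M. - ((1 - s) gchoose (2 * i)) / of_nat (2 * i + 1) * g (s + 2 * of_nat i))
    + (\<Sum>n. telescope_remainder M (node a n) s) / 2)"
  have "G holomorphic_on {s. 1 - real (Suc N) < Re s}"
    unfolding G_def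
  proof (intro holomorphic_intros)
    show "(\<lambda>s. \<Sum>n. telescope_remainder M (node a n) s) holomorphic_on {s. 1 - real (Suc N) < Re s}"
      by (rule holomorphic_on_subset[OF holomorphic_telescope_remainder_sum[OF a]])
         (auto simp: M_def)
    show "(\<lambda>s. g (s + 2 * of_nat i)) holomorphic_on {s. 1 - real (Suc N) < Re s}"
      if "i \<in> {1..<M}" for i
    proof -
      have "(g \<circ> (\<lambda>s. s + 2 * of_nat i)) holomorphic_on {s. 1 - real (Suc N) < Re s}"
        by (rule holomorphic_on_compose_gen[OF _ g(1)]) (use that in \<open>auto intro!: holomorphic_intros\<close>)
      thus ?thesis by (simp add: o_def)
    qed
  qed (use a in \<open>auto simp del: of_nat_add of_nat_Suc simp: complex_eq_iff\<close>)
  moreover have "G s = (s - 1) * node_zeta a s" if s: "1 < Re s" for s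
  proof -
    have "- ((1 - s) gchoose (2 * i)) / of_nat (2 * i + 1) * g (s + 2 * of_nat i) =
          ((1 - s) gchoose (2 * i + 1)) * node_zeta a (s + 2 * of_nat i)" for i
    proof -
      have "(1 - s - of_nat (2 * i)) * ((1 - s) gchoose (2 * i)) =
              of_nat (2 * i + 1) * ((1 - s) gchoose (2 * i + 1))"
        using gbinomial_mult_1[of "1 - s" "2 * i"] by (simp add: algebra_simps)
      hence "((1 - s) gchoose (2 * i + 1)) =
        (1 - s - of_nat (2 * i)) * ((1 - s) gchoose (2 * i)) / of_nat (2 * i + 1)"
        by (simp add: field_simps del: of_nat_add of_nat_Suc)
      moreover have "g (s + 2 * of_nat i) = (s + 2 * of_nat i - 1) * node_zeta a (s + 2 * of_nat i)"
        using s by (intro g(2)) auto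
      ultimately show ?thesis
        by (simp only: divide_inverse) (simp add: algebra_simps del: of_nat_add of_nat_Suc)
    qed
    thus ?thesis
      unfolding G_def using node_zeta_recurrence[OF a s, of M] by (simp add: M_def)
  qed
  ultimately show ?case by blast
qed

theorem node_zeta_continuation:
  assumes a: "a \<ge> 0"
  obtains H where "H holomorphic_on UNIV" "\<And>s. 1 < Re s \<Longrightarrow> H s = (s - 1) * node_zeta a s"
     "H 1 = 1 / 2"
proof -
  obtain H where H: "H holomorphic_on UNIV" "\<And>s. 1 < Re s \<Longrightarrow> H s = (s - 1) * node_zeta a s"
    using entire_extension[OF node_zeta_partial_extension[OF a]] by blast
  \<comment> \<open>The right-hand side of the recurrence for \<open>M = 1\<close>, where the middle
    sum is empty; it is holomorphic for \<open>Re s > -1\<close> and so can be evaluated at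
    1.\<close>
  define G where "G = (\<lambda>s. of_real (1 + a) powr (1 - s) / 2
    + (\<Sum>n. telescope_remainder 1 (node a n) s) / 2)"
  have "H 1 = G 1"
  proof (rule holomorphic_eq_on_halfplane[where c = "-1" and d = 1 and f = H and g = G])
    show "G holomorphic_on {s. - 1 < Re s}"
      unfolding G_def using holomorphic_telescope_remainder_sum[OF a, of 1] a
      by (intro holomorphic_intros) (auto simp: complex_eq_iff)
    show "H s = G s" if "1 < Re s" for s
      using node_zeta_recurrence[OF a that, of 1] H(2)[OF that] by (simp add: G_def)
  qed (use H in \<open>auto intro: holomorphic_on_subset\<close>)
  \<comment> \<open>At \<open>w = 1\<close> both powers are 1 and \<open>0 gchoose 1 = 0\<close>, so
    only \<open>(1 + a) powr 0 / 2\<close> is left of \<open>G 1\<close>.\<close>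
  also have "telescope_remainder 1 (node a n) 1 = 0" for n
    using a by (simp add: telescope_remainder_def node_def complex_eq_iff)
  hence "G 1 = 1 / 2"
    using a by (simp add: G_def complex_eq_iff[of "1 + _"])
  finally show ?thesis using that H by blast
qed

subsection \<open>Quadratic bases\<close>

text \<open>The powers of \<open>y\<close> are collected so that summation over the nodes turns each
  subtracted term into a value of \<open>node_zeta\<close>.\<close>

definition quad_remainder :: "real \<Rightarrow> real \<Rightarrow> nat \<Rightarrow> nat \<Rightarrow> complex \<Rightarrow> complex" where
  "quad_remainder a y d M s = of_real y ^ d * of_real (y\<^sup>2 - a\<^sup>2) powr (-s)
     - (\<Sum>m<M. ((-s) gchoose m) * (- (of_real a ^ 2)) ^ m *
          of_real y powr (-(2 * s + 2 * of_nat m - of_nat d)))"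

text \<open>\<open>\<rho>\<close> bounds \<open>a^2 / y^2\<close> for all
  \<open>y \<ge> 2 + a\<close> at once; the numerator \<open>1 + a\<close> in place of
  \<open>a\<close> keeps it positive for \<open>a = 0\<close>. The rest is
  \<open>binomial_series_remainder\<close> at \<open>u = - (a^2 / y^2)\<close>.\<close>

lemma norm_quad_remainder_le:
  assumes a: "a \<ge> 0" and y: "y \<ge> 2 + a" and \<rho>: "\<rho> = ((1 + a) / (2 + a))\<^sup>2"
  shows "norm (quad_remainder a y d M s) \<le>
           (a\<^sup>2 / \<rho>) ^ M * (1 - \<rho>) powr (- norm s) * y powr (-(2 * Re s + (2 * real M - real d)))"
proof -
  define u where "u = complex_of_real (- (a\<^sup>2 / y\<^sup>2))"
  define C where "C = of_real y ^ d * complex_of_real y powr (- (2 * s))"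
  have ypos: "y > 0" "a < y" using a y by auto
  have \<rho>01: "0 < \<rho>" "\<rho> < 1"
    using a unfolding \<rho> by (auto simp: power_less_one_iff)
  have au: "norm u = a\<^sup>2 / y\<^sup>2"
    by (simp add: u_def norm_divide norm_power)
  have "a / y \<le> (1 + a) / (2 + a)"
    using a y by (intro frac_le) auto
  hence u: "norm u \<le> \<rho>"
    unfolding au \<rho> power_divide [symmetric] using a ypos by (intro power_mono) auto
  \<comment> \<open>An iterated product with nonnegative real left factors, for which
    \<open>powr\<close> is multiplicative; \<open>y powr (-s)\<close> comes out twice.\<close>
  have "complex_of_real (y\<^sup>2 - a\<^sup>2) = of_real y * (of_real y * of_real (1 - a\<^sup>2 / y\<^sup>2))"
    using ypos by (simp add: field_simps power2_eq_square flip: of_real_mult)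
  also have "\<dots> powr (-s) = of_real y powr (-s) * (of_real y powr (-s) * of_real (1 - a\<^sup>2 / y\<^sup>2) powr (-s))"
    using ypos by (simp only: powr_times_real_left Reals_of_real Re_complex_of_real less_imp_le)
  also have "\<dots> = of_real y powr (-(2 * s)) * (1 + u) powr (-s)"
    by (simp add: u_def powr_add [symmetric] mult.assoc [symmetric])
  finally have main: "of_real y ^ d * of_real (y\<^sup>2 - a\<^sup>2) powr (-s) = C * (1 + u) powr (-s)"
    by (simp add: C_def)
  have "(- (of_real a ^ 2)) ^ m * of_real y powr (-(2 * s + 2 * of_nat m - of_nat d)) = C * u ^ m" for m
  proof -
    have "-(2 * s + 2 * of_nat m - of_nat d) = -(2 * s) + of_nat d - of_nat (2 * m)"
      by simp
    also have "of_real y powr \<dots> = of_real y powr (-(2 * s)) * of_real y ^ d / of_real y ^ (2 * m)"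
      using ypos powr_complexpow[of "complex_of_real y" "2*m"] powr_complexpow[of "complex_of_real y" d]
      by (subst powr_diff, subst powr_add) (simp del: powr_complexpow)
    finally show ?thesis
      by (simp add: u_def C_def power_mult power_divide power_minus[of "_ / _"]
            power_minus[of "complex_of_real a ^ 2"])
  qed
  hence "quad_remainder a y d M s = C * ((1 + u) powr (-s) - (\<Sum>m<M. ((-s) gchoose m) * u ^ m))"
    unfolding quad_remainder_def main by (simp add: right_diff_distrib sum_distrib_left mult_ac)
  also have "norm \<dots> \<le> norm C * ((norm u / \<rho>) ^ M * (1 - \<rho>) powr (- norm (-s)))"
    unfolding norm_mult
    by (intro mult_left_mono binomial_series_remainder \<rho>01 u) auto
  also have "norm C = y powr (real d - 2 * Re s)"
    unfolding C_def norm_mult norm_power using ypos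
    by (simp add: norm_of_real_powr powr_diff powr_realpow powr_minus divide_inverse norm_inverse)
  also have "y powr (real d - 2 * Re s) * ((norm u / \<rho>) ^ M * (1 - \<rho>) powr (- norm (-s))) =
       (a\<^sup>2 / \<rho>) ^ M * (1 - \<rho>) powr (- norm s) * (y powr (real d - 2 * Re s) / y ^ (2 * M))"
    by (simp only: au power_divide power_mult norm_minus_cancel) (simp only: divide_inverse mult_ac)
  also have "y powr (real d - 2 * Re s) / y ^ (2 * M) = y powr (real d - 2 * Re s - real (2 * M))"
    using ypos by (subst powr_diff[of _ _ "real (2*M)"], subst powr_realpow) auto
  also have "real d - 2 * Re s - real (2 * M) = -(2 * Re s + (2 * real M - real d))"
    by simp
  finally show ?thesis .
qed

lemma
  assumes a: "a \<ge> 0"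
  shows holomorphic_quad_remainder_sum:
      "(\<lambda>s. \<Sum>n. quad_remainder a (node a n) d M s)
         holomorphic_on {s. (real d + 1) / 2 - real M < Re s}"
    and summable_quad_remainder:
      "(real d + 1) / 2 - real M < Re s \<Longrightarrow> summable (\<lambda>n. quad_remainder a (node a n) d M s)"
proof -
  define \<rho> where "\<rho> = ((1 + a) / (2 + a))\<^sup>2"
  have \<rho>01: "0 < \<rho>" "\<rho> < 1"
    using a unfolding \<rho>_def by (auto simp: power_less_one_iff)
  have hol: "(\<lambda>s. quad_remainder a (node a n) d M s) holomorphic_on UNIV" for n
    unfolding quad_remainder_def by (intro holomorphic_intros)
  have bound: "norm (quad_remainder a (node a n) d M s) \<le>
      (a\<^sup>2 / \<rho>) ^ M * (1 - \<rho>) powr (- norm s) * node a n powr (-(2 * Re s + (2 * real M - real d)))" for n s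
    by (rule norm_quad_remainder_le[OF a node_ge(2)[OF a] \<rho>_def])
  have B: "mono (\<lambda>x::real. (a\<^sup>2 / \<rho>) ^ M * (1 - \<rho>) powr (- x))"
    using \<rho>01 by (auto simp: mono_def intro!: mult_left_mono powr_mono')
  have B0: "0 \<le> (a\<^sup>2 / \<rho>) ^ M * (1 - \<rho>) powr (- x)" for x :: real
    using \<rho>01 by simp
  have y: "node a n \<ge> real (Suc n)" for n
    by (rule node_ge(1)[OF a])
  have dom: "(real d + 1) / 2 - real M < Re s \<longleftrightarrow> 2 * Re s + (2 * real M - real d) > 1" for s
    by (auto simp: field_simps)
  show "(\<lambda>s. \<Sum>n. quad_remainder a (node a n) d M s)
         holomorphic_on {s. (real d + 1) / 2 - real M < Re s}"
    unfolding dom by (rule holomorphic_dirichlet_sum[OF hol _ y B B0 bound]) auto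
  show "summable (\<lambda>n. quad_remainder a (node a n) d M s)" if "(real d + 1) / 2 - real M < Re s"
    using that unfolding dom by (intro summable_dirichlet_sum[OF hol _ y B B0 bound]) auto
qed

definition quad_series :: "real \<Rightarrow> nat \<Rightarrow> complex \<Rightarrow> complex" where
  "quad_series a d s = (\<Sum>n. of_real (node a n) ^ d * of_real ((node a n)\<^sup>2 - a\<^sup>2) powr (-s))"

text \<open>Valid for every \<open>M\<close>: \<open>M = 0\<close> merely gives convergence, larger
  \<open>M\<close> exposes more poles.\<close>

lemma quad_series_sums:
  assumes a: "a \<ge> 0" and s: "(real d + 1) / 2 < Re s"
  shows "(\<lambda>n. of_real (node a n) ^ d * of_real ((node a n)\<^sup>2 - a\<^sup>2) powr (-s)) sums
     ((\<Sum>m<M. ((-s) gchoose m) * (- (of_real a ^ 2)) ^ m *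
          node_zeta a (2 * s + 2 * of_nat m - of_nat d)) + (\<Sum>n. quad_remainder a (node a n) d M s))"
proof -
  have Z: "(\<lambda>n. of_real (node a n) powr (-(2 * s + 2 * of_nat m - of_nat d))) sums
          node_zeta a (2 * s + 2 * of_nat m - of_nat d)" for m
    unfolding node_zeta_def using s by (intro summable_sums summable_node_zeta a) (auto simp: field_simps)
  have R: "(\<lambda>n. quad_remainder a (node a n) d M s) sums (\<Sum>n. quad_remainder a (node a n) d M s)"
    using s by (intro summable_sums summable_quad_remainder a) linarith
  have "(\<lambda>n. (\<Sum>m<M. ((-s) gchoose m) * (- (of_real a ^ 2)) ^ m *
            of_real (node a n) powr (-(2 * s + 2 * of_nat m - of_nat d)))
          + quad_remainder a (node a n) d M s) sums
     ((\<Sum>m<M. ((-s) gchoose m) * (- (of_real a ^ 2)) ^ m *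
          node_zeta a (2 * s + 2 * of_nat m - of_nat d)) + (\<Sum>n. quad_remainder a (node a n) d M s))"
    by (intro sums_add R sums_sum sums_mult Z)
  thus ?thesis
    by (simp add: quad_remainder_def)
qed

lemma sum_lessThan_shift:
  fixes f :: "nat \<Rightarrow> nat \<Rightarrow> 'a :: comm_monoid_add"
  shows "(\<Sum>n<N. if h \<le> n then f n (n - h) else 0) = (\<Sum>m<N-h. f (m + h) m)"
proof (induction N)
  case (Suc N)
  thus ?case
    by (cases "h \<le> N") (auto simp: Suc_diff_le)
qed auto

text \<open>The offset \<open>h\<close> lets series of different degrees share one
  \<open>\<sigma>\<close>: this one converges for \<open>Re s > \<sigma> - h\<close>, so its poles
  start at index \<open>h\<close>. The factor 1/4 is \<open>H 1 = 1 / 2\<close> times the 1/2 from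
  \<open>w - 1 = 2 * (s - p (m + h))\<close>.\<close>

lemma polar_expansion_quad_series:
  assumes a: "a \<ge> 0" and \<sigma>: "\<sigma> = (real d + 1) / 2 + real h"
  shows "polar_expansion \<sigma> (quad_series a d)
     (\<lambda>n. if h \<le> n then (of_real (real n - \<sigma>) gchoose (n - h)) * (- (of_real a ^ 2)) ^ (n - h) / 4 else 0)"
    (is "polar_expansion _ _ ?r")
  unfolding polar_expansion_def
proof
  fix N
  define p where "p = (\<lambda>n. complex_of_real (\<sigma> - real n))"
  \<comment> \<open>The terms \<open>m < N - h\<close> have their poles at the indices
    \<open>h\<close> to \<open>N - 1\<close>. For \<open>N < h\<close> truncation gives
    \<open>M = 0\<close>, and the series itself is holomorphic on the half-plane.\<close>
  define M where "M = N - h"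
  obtain H where H: "H holomorphic_on UNIV" "\<And>s. 1 < Re s \<Longrightarrow> H s = (s - 1) * node_zeta a s" "H 1 = 1 / 2"
    using node_zeta_continuation[OF a] by blast
  define \<phi> where "\<phi> = (\<lambda>m s. ((-s) gchoose m) * (- (of_real a ^ 2)) ^ m * H (2 * (s - p (m + h)) + 1) / 2)"
  have "\<phi> m holomorphic_on UNIV" for m
  proof -
    have "(H \<circ> (\<lambda>s. 2 * (s - p (m + h)) + 1)) holomorphic_on UNIV"
      by (intro holomorphic_on_compose_gen[OF _ H(1)] holomorphic_intros) auto
    thus ?thesis unfolding \<phi>_def o_def by (intro holomorphic_intros) auto
  qed
  hence "\<exists>\<psi>. \<psi> holomorphic_on UNIV \<and>
      (\<forall>s. s \<noteq> p (m + h) \<longrightarrow> \<phi> m s / (s - p (m + h)) = \<phi> m (p (m + h)) / (s - p (m + h)) + \<psi> s)" for m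
    using polar_part_entire_quotient[of "\<phi> m" "p (m + h)"] by metis
  then obtain \<psi> where \<psi>: "\<And>m. \<psi> m holomorphic_on UNIV"
      "\<And>m s. s \<noteq> p (m + h) \<Longrightarrow> \<phi> m s / (s - p (m + h)) = \<phi> m (p (m + h)) / (s - p (m + h)) + \<psi> m s"
    by metis
  define g where "g = (\<lambda>s. (\<Sum>m<M. \<psi> m s) + (\<Sum>n. quad_remainder a (node a n) d M s))"
  have "g holomorphic_on {s. \<sigma> - real N < Re s}"
    unfolding g_def
  proof (intro holomorphic_intros)
    show "(\<lambda>s. \<Sum>n. quad_remainder a (node a n) d M s) holomorphic_on {s. \<sigma> - real N < Re s}"
      by (rule holomorphic_on_subset[OF holomorphic_quad_remainder_sum[OF a]])
         (auto simp: \<sigma> M_def)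
  qed (use \<psi>(1) in \<open>auto intro: holomorphic_on_subset\<close>)
  moreover have "quad_series a d s = (\<Sum>n<N. ?r n / (s - complex_of_real (\<sigma> - real n))) + g s"
    if s: "\<sigma> < Re s" for s
  proof -
    have "quad_series a d s = (\<Sum>m<M. ((-s) gchoose m) * (- (of_real a ^ 2)) ^ m *
          node_zeta a (2 * s + 2 * of_nat m - of_nat d)) + (\<Sum>n. quad_remainder a (node a n) d M s)"
      unfolding quad_series_def using s \<sigma>
      by (intro sums_unique [symmetric] quad_series_sums a) linarith
    also have "(\<Sum>m<M. ((-s) gchoose m) * (- (of_real a ^ 2)) ^ m *
                  node_zeta a (2 * s + 2 * of_nat m - of_nat d)) =
               (\<Sum>m<M. \<phi> m (p (m + h)) / (s - p (m + h)) + \<psi> m s)"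
    proof (intro sum.cong refl)
      fix m
      define w where "w = 2 * s + 2 * of_nat m - of_nat d"
      have w: "w = 2 * (s - p (m + h)) + 1"
        by (simp add: w_def p_def \<sigma> field_simps)
      have ne: "s \<noteq> p (m + h)"
        using s by (auto simp: p_def)
      have "Re w > 1"
        using s by (simp add: w p_def)
      hence "node_zeta a w = H w / (w - 1)"
        using H(2)[of w] by auto
      hence "node_zeta a w = H w / (2 * (s - p (m + h)))"
        by (simp add: w)
      hence "((-s) gchoose m) * (- (of_real a ^ 2)) ^ m * node_zeta a w = \<phi> m s / (s - p (m + h))"
        by (simp add: \<phi>_def w)
      also have "\<dots> = \<phi> m (p (m + h)) / (s - p (m + h)) + \<psi> m s"
        by (rule \<psi>(2)[OF ne])
      finally show "((-s) gchoose m) * (- (of_real a ^ 2)) ^ m * node_zeta a (2 * s + 2 * of_nat m - of_nat d) = \<dots>"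
        by (simp add: w_def)
    qed
    also have "\<dots> = (\<Sum>m<M. \<phi> m (p (m + h)) / (s - p (m + h))) + (\<Sum>m<M. \<psi> m s)"
      by (simp add: sum.distrib)
    also have "(\<Sum>m<M. \<phi> m (p (m + h)) / (s - p (m + h))) =
       (\<Sum>n<N. if h \<le> n then \<phi> (n - h) (p n) / (s - p n) else 0)"
      unfolding M_def by (rule sum_lessThan_shift [symmetric, where f = "\<lambda>n m. \<phi> m (p n) / (s - p n)"])
    also have "\<dots> = (\<Sum>n<N. ?r n / (s - p n))"
      by (intro sum.cong) (auto simp: \<phi>_def p_def H(3))
    finally show ?thesis
      by (simp add: g_def p_def)
  qed
  ultimately show "\<exists>g. g holomorphic_on {s. \<sigma> - real N < Re s} \<and> (\<forall>s. \<sigma> < Re s \<longrightarrow>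
      quad_series a d s = (\<Sum>n<N. ?r n / (s - complex_of_real (\<sigma> - real n))) + g s)"
    by blast
qed

subsection \<open>The zeta function of projective space\<close>

text \<open>Splitting \<open>2 * x + k - 1\<close> as \<open>x + (x + k - 1)\<close> gives two
  rising products, \<open>(x + 1) ... (x + k - 1)\<close> and \<open>x ... (x + k - 2)\<close>; the
  first is \<open>pochhammer x k\<close> divided by \<open>x\<close>, whence the index
  \<open>Suc j\<close>.\<close>

lemma fact_times_P_poly:
  assumes k: "k \<ge> 2"
  shows "fact (k - 1) * P_poly k x =
           (\<Sum>j<k. (real (stirling k (Suc j)) + real (stirling (k - 1) j)) * x ^ j)"
proof -
  obtain m where m: "k = Suc (Suc m)"
    using k by (metis add_2_eq_Suc le_Suc_ex)
  have prod: "(\<Prod>i=1..m. x + real i) = pochhammer (x + 1) m"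
    unfolding pochhammer_prod by (rule prod.reindex_bij_witness[of _ Suc "\<lambda>i. i - 1"]) auto
  have "(\<Sum>j<k. real (stirling k (Suc j)) * x ^ j) = pochhammer (x + 1) (Suc m)"
  proof (cases "x = 0")
    case True
    have "(\<Sum>j<k. real (stirling k (Suc j)) * x ^ j) = real (stirling k 1)"
      using True m by (simp add: sum.lessThan_Suc_shift del: stirling.simps sum.lessThan_Suc)
    thus ?thesis
      using True stirling_Suc_n_1[of "Suc m"]
      by (simp add: m pochhammer_fact [symmetric] del: stirling.simps fact_Suc)
  next
    case False
    have "x * (\<Sum>j<k. real (stirling k (Suc j)) * x ^ j) = (\<Sum>j<Suc k. real (stirling k j) * x ^ j)"
      using k by (subst sum.lessThan_Suc_shift) (simp add: sum_distrib_left mult_ac)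
    also have "\<dots> = x * pochhammer (x + 1) (Suc m)"
      using stirling_pochhammer[of k x]
      by (simp only: m lessThan_Suc_atMost pochhammer_rec)
    finally show ?thesis using False by simp
  qed
  moreover have "(\<Sum>j<k. real (stirling (k - 1) j) * x ^ j) = x * pochhammer (x + 1) m"
    using stirling_pochhammer[of "Suc m" x]
    by (simp only: m diff_Suc_1 lessThan_Suc_atMost pochhammer_rec)
  moreover have "fact (k - 1) * P_poly k x = (2 * x + real k - 1) * pochhammer (x + 1) m"
    using prod by (simp add: P_poly_def m del: fact_Suc)
  ultimately show ?thesis
    by (simp add: m distrib_right sum.distrib pochhammer_Suc algebra_simps
             del: stirling.simps sum.lessThan_Suc)
qed

text \<open>Both signed numbers carry the sign \<open>(-1) ^ (k + j + p + 1)\<close>, so together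
  with the prefactor only \<open>(-1) ^ p\<close> remains.\<close>

lemma B_coeff_unsigned:
  assumes "j < k"
  shows "B_coeff k j = (\<Sum>p\<le>k-1-j. real ((j + p) choose j) * (- ((real k - 1) / 2)) ^ p *
           (real (stirling k (Suc (j + p))) + real (stirling (k - 1) (j + p))))"
proof -
  obtain m where m: "k = Suc m"
    using assms by (cases k) auto
  have "(-1) ^ (k + j + 1) * real ((j + p) choose j) * ((real k - 1) / 2) ^ p
      * of_int (signed_stirling k (j + p + 1) + signed_stirling (k - 1) (j + p)) =
    real ((j + p) choose j) * (- ((real k - 1) / 2)) ^ p *
      (real (stirling k (Suc (j + p))) + real (stirling (k - 1) (j + p)))" for p
    unfolding signed_stirling_def m power_minus[of "(real _ - 1) / 2"]
    by (cases "even m"; cases "even j"; cases "even p") (simp_all add: algebra_simps)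
  moreover have "{0..k-j-1} = {..k-1-j}"
    by auto
  ultimately show ?thesis
    unfolding B_coeff_def by simp
qed

text \<open>Expand each \<open>(x - a) ^ j\<close> binomially and collect the powers
  \<open>x ^ i\<close> with \<open>p = j - i\<close>.\<close>

lemma sum_B_coeff:
  assumes k: "k \<ge> 2"
  shows "(\<Sum>j<k. B_coeff k j * x ^ j) = fact (k - 1) * P_poly k (x - (real k - 1) / 2)"
proof -
  define a where "a = (real k - 1) / 2"
  define c where "c = (\<lambda>j. real (stirling k (Suc j)) + real (stirling (k - 1) j))"
  define t where "t = (\<lambda>i j. c j * (real (j choose i) * x ^ i * (- a) ^ (j - i)))"
  have "fact (k - 1) * P_poly k (x - a) = (\<Sum>j<k. c j * (x + (- a)) ^ j)"
    using fact_times_P_poly[OF k, of "x - a"] by (simp add: c_def)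
  also have "\<dots> = (\<Sum>j<k. \<Sum>i\<le>j. t i j)"
    unfolding binomial_ring by (simp add: t_def sum_distrib_left)
  also have "\<dots> = (\<Sum>(j, i)\<in>(SIGMA j:{..<k}. {..j}). t i j)"
    by (simp add: sum.Sigma)
  also have "\<dots> = (\<Sum>(i, p)\<in>(SIGMA i:{..<k}. {..k-1-i}). t i (i + p))"
    by (rule sum.reindex_bij_witness[of _ "\<lambda>(i, p). (i + p, i)" "\<lambda>(j, i). (i, j - i)"]) auto
  also have "\<dots> = (\<Sum>i<k. \<Sum>p\<le>k-1-i. t i (i + p))"
    by (simp add: sum.Sigma)
  also have "\<dots> = (\<Sum>j<k. B_coeff k j * x ^ j)"
    by (intro sum.cong refl)
       (simp add: B_coeff_unsigned t_def c_def a_def sum_distrib_right sum_distrib_left mult_ac)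
  finally show ?thesis by (simp add: a_def)
qed

lemma P_poly_centred:
  "fact (k - 1) * P_poly k (x - (real k - 1) / 2) =
     2 * x * (\<Prod>i=1..k-2. x - (real k - 1) / 2 + real i)"
  by (simp add: P_poly_def)

text \<open>The factor \<open>2 * x\<close> of the centred polynomial kills the constant
  coefficient; its parity, that of \<open>k - 1\<close>, kills every second one.\<close>

lemma B_coeff_eq_0:
  assumes k: "k \<ge> 2" and j: "j < k" and odd: "odd (k - 1 - j) \<or> j = 0"
  shows "B_coeff k j = 0"
proof -
  define a where "a = (real k - 1) / 2"
  have a2: "2 * a = real k - 1"
    by (simp add: a_def)
  define Q where "Q = (\<lambda>x. 2 * x * (\<Prod>i=1..k-2. x - a + real i))"
  have Q: "(\<Sum>i\<le>k-1. B_coeff k i * x ^ i) = Q x" for x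
  proof -
    have "{..k-1} = {..<k}" using k by auto
    thus ?thesis
      using sum_B_coeff[OF k, of x] P_poly_centred[of k x] by (simp add: Q_def a_def)
  qed
  have "B_coeff k 0 = 0"
  proof -
    have "B_coeff k 0 = (\<Sum>i\<le>k-1. B_coeff k i * 0 ^ i)"
      by (simp add: sum.atMost_shift)
    also have "\<dots> = 0"
      unfolding Q by (simp add: Q_def)
    finally show ?thesis .
  qed
  moreover have "B_coeff k j = 0" if "odd (k - 1 - j)"
  proof -
    have "Q (-x) = (-1) ^ (k - 1) * Q x" for x
    proof -
      have "(\<Prod>i=1..k-2. - x - a + real i) = (\<Prod>i=1..k-2. (-1) * (x - a + real i))"
      \<comment> \<open>Passing from \<open>i\<close> to \<open>k - 1 - i\<close> changes the sign
        of \<open>real i - a\<close>, since \<open>2 * a = k - 1\<close>.\<close>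
      proof (rule prod.reindex_bij_witness[of _ "\<lambda>i. k - 1 - i" "\<lambda>i. k - 1 - i"])
        fix i assume "i \<in> {1..k-2}"
        hence "real (k - 1 - i) = real k - 1 - real i"
          by (auto simp: of_nat_diff)
        thus "(-1) * (x - a + real (k - 1 - i)) = - x - a + real i"
          using a2 by simp
      qed (use k in auto)
      also have "\<dots> = (-1) ^ (k - 2) * (\<Prod>i=1..k-2. x - a + real i)"
        by (subst prod.distrib) simp
      moreover have "k - 1 = Suc (k - 2)" using k by simp
      ultimately show ?thesis by (simp add: Q_def)
    qed
    moreover have "(\<Sum>i\<le>k-1. (B_coeff k i * (-1) ^ i) * x ^ i) = Q (-x)" for x
      unfolding Q [symmetric] power_minus[of x] by (simp only: mult.assoc)
    moreover have "(\<Sum>i\<le>k-1. ((-1) ^ (k - 1) * B_coeff k i) * x ^ i) = (-1) ^ (k - 1) * Q x" for x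
      unfolding Q [symmetric] sum_distrib_left by (simp only: mult.assoc)
    ultimately have "\<forall>x. (\<Sum>i\<le>k-1. (B_coeff k i * (-1) ^ i) * x ^ i) =
               (\<Sum>i\<le>k-1. ((-1) ^ (k - 1) * B_coeff k i) * x ^ i)"
      by metis
    hence "B_coeff k j * (-1) ^ j = (-1) ^ (k - 1) * B_coeff k j"
      unfolding polyfun_eq_coeffs using j by simp
    thus ?thesis
      using that j by (cases "even j"; cases "even (k - 1)") auto
  qed
  ultimately show ?thesis using odd by auto
qed

text \<open>For odd \<open>k\<close> the exponent 0 has the right parity but its coefficient
  vanishes, so the range ends at \<open>(k - 2) div 2\<close> for either parity.\<close>

lemma P_poly_eq_sum_B_coeff:
  assumes k: "k \<ge> 2"
  shows "fact (k - 1) * P_poly k (x - (real k - 1) / 2) =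
           (\<Sum>h=0..(k-2) div 2. B_coeff k (k - 2 * h - 1) * x ^ (k - 2 * h - 1))"
proof -
  let ?f = "\<lambda>h. k - 2 * h - 1"
  have inj: "inj_on ?f {0..(k-2) div 2}"
    by (rule inj_onI) (use k in auto)
  have "j \<in> ?f ` {0..(k-2) div 2}" if j: "j < k" "even (k - 1 - j)" "j \<noteq> 0" for j
  proof -
    obtain h where "k - 1 - j = 2 * h" using j(2) by (elim evenE)
    thus ?thesis using j by (intro image_eqI[of _ _ h]) auto
  qed
  hence "B_coeff k j = 0" if "j < k" "j \<notin> ?f ` {0..(k-2) div 2}" for j
    using B_coeff_eq_0[OF k that(1)] that by blast
  hence "(\<Sum>j<k. B_coeff k j * x ^ j) = (\<Sum>j\<in>?f ` {0..(k-2) div 2}. B_coeff k j * x ^ j)"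
    using k by (intro sum.mono_neutral_right ballI) auto
  also have "\<dots> = (\<Sum>h=0..(k-2) div 2. B_coeff k (?f h) * x ^ ?f h)"
    by (subst sum.reindex[OF inj]) simp
  finally show ?thesis
    by (simp add: sum_B_coeff[OF k])
qed

lemma B_coeff_top: "k \<ge> 2 \<Longrightarrow> B_coeff k (k - 1) = 2"
  by (subst B_coeff_unsigned) auto

section \<open>Poles and residues of the zeta function\<close>

lemma mp_term_eq_sum:
  assumes k: "k \<ge> 2" and a: "a = (real k - 1) / 2"
  shows "mp_term k s (Suc n) = (\<Sum>h=0..(k-2) div 2. of_real (B_coeff k (k - 2 * h - 1) / fact (k - 1)) *
           (of_real (node a n) ^ (k - 2 * h - 1) * of_real ((node a n)\<^sup>2 - a\<^sup>2) powr (-s)))"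
proof -
  have "fact (k - 1) * P_poly k (2 * real (Suc n)) =
          (\<Sum>h=0..(k-2) div 2. B_coeff k (k - 2 * h - 1) * node a n ^ (k - 2 * h - 1))"
    using P_poly_eq_sum_B_coeff[OF k, of "node a n"] by (simp add: node_def a)
  hence "P_poly k (2 * real (Suc n)) =
          (\<Sum>h=0..(k-2) div 2. B_coeff k (k - 2 * h - 1) / fact (k - 1) * node a n ^ (k - 2 * h - 1))"
    by (simp add: field_simps sum_divide_distrib [symmetric])
  moreover have "2 * real (Suc n) * (2 * real (Suc n) + real k - 1) = (node a n)\<^sup>2 - a\<^sup>2"
    by (simp add: node_def a power2_eq_square field_simps)
  ultimately have "mp_term k s (Suc n) = of_real (\<Sum>h=0..(k-2) div 2.
      B_coeff k (k - 2 * h - 1) / fact (k - 1) * node a n ^ (k - 2 * h - 1)) /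
      of_real ((node a n)\<^sup>2 - a\<^sup>2) powr s"
    unfolding mp_term_def by (simp only:)
  thus ?thesis
    unfolding powr_minus divide_inverse[of _ "_ powr s"] of_real_sum of_real_mult of_real_power
      sum_distrib_right mult.assoc .
qed

definition mp_residue :: "nat \<Rightarrow> nat \<Rightarrow> real" where
  "mp_residue k n = 1 / (4 * fact (k - 1)) *
     (\<Sum>h=0..min n ((k - 2) div 2).
        (-1) ^ (n - h) * ((real k - 1) / 2) ^ (2 * n - 2 * h)
        * ((real n - real k / 2) gchoose (n - h)) * B_coeff k (k - 2 * h - 1))"

lemma gbinomial_of_real: "complex_of_real x gchoose m = of_real (x gchoose m)"
  by (simp add: gbinomial_prod_rev)

lemma mp_zeta_expansion:
  assumes k: "k \<ge> 2"
  shows "real k / 2 < Re s \<Longrightarrow> summable (\<lambda>n. mp_term k s (Suc n))"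
    and "polar_expansion (real k / 2) (mp_zeta k) (\<lambda>n. of_real (mp_residue k n))"
proof -
  define a where "a = (real k - 1) / 2"
  have a: "a \<ge> 0" using k by (simp add: a_def)
  define b where "b = (\<lambda>h. complex_of_real (B_coeff k (k - 2 * h - 1) / fact (k - 1)))"
  have deg: "real (k - 2 * h - 1) = real k - 2 * real h - 1" if "h \<in> {0..(k-2) div 2}" for h
    using that k by (auto simp: of_nat_diff)
  have sums: "(\<lambda>n. mp_term k s (Suc n)) sums (\<Sum>h=0..(k-2) div 2. b h * quad_series a (k - 2 * h - 1) s)"
    if s: "real k / 2 < Re s" for s
    unfolding mp_term_eq_sum[OF k a_def] b_def
  proof (intro sums_sum sums_mult)
    fix h assume h: "h \<in> {0..(k-2) div 2}"
    have "(real (k - 2 * h - 1) + 1) / 2 < Re s"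
      unfolding deg[OF h] using s by simp
    from quad_series_sums[OF a this, of 0]
    show "(\<lambda>n. of_real (node a n) ^ (k - 2 * h - 1) * of_real ((node a n)\<^sup>2 - a\<^sup>2) powr (-s)) sums
            quad_series a (k - 2 * h - 1) s"
      unfolding quad_series_def by (simp add: sums_iff)
  qed
  show "real k / 2 < Re s \<Longrightarrow> summable (\<lambda>n. mp_term k s (Suc n))"
    using sums by (simp add: sums_iff)
  let ?r = "\<lambda>h n. if h \<le> n then (of_real (real n - real k / 2) gchoose (n - h)) *
                    (- (of_real a ^ 2)) ^ (n - h) / 4 else 0"
  have "polar_expansion (real k / 2) (\<lambda>s. \<Sum>h=0..(k-2) div 2. b h * quad_series a (k - 2 * h - 1) s)
          (\<lambda>n. \<Sum>h=0..(k-2) div 2. b h * ?r h n)"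
    by (intro polar_expansion_sum polar_expansion_cmult polar_expansion_quad_series a)
       (simp only: deg, simp add: field_simps)
  moreover have "(\<Sum>h=0..(k-2) div 2. b h * ?r h n) = of_real (mp_residue k n)" for n
  proof -
    \<comment> \<open>\<open>?r h n\<close> vanishes for \<open>h > n\<close>, which produces the
      \<open>min\<close> of the residue formula.\<close>
    have "(\<Sum>h=0..(k-2) div 2. b h * ?r h n) =
          (\<Sum>h=0..min n ((k-2) div 2). b h * ?r h n)"
      by (intro sum.mono_neutral_right) auto
    also have "\<dots> = of_real (mp_residue k n)"
      unfolding mp_residue_def of_real_mult of_real_sum sum_distrib_left
    proof (intro sum.cong refl)
      fix h assume h: "h \<in> {0..min n ((k-2) div 2)}"
      have "(- (complex_of_real a ^ 2)) ^ (n - h) = (-1) ^ (n - h) * of_real a ^ (2 * n - 2 * h)"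
        by (simp add: power_minus[of "of_real a ^ 2"] power_mult [symmetric] diff_mult_distrib2)
      thus "b h * ?r h n = of_real (1 / (4 * fact (k - 1))) *
              (of_real ((- 1) ^ (n - h)) * of_real (((real k - 1) / 2) ^ (2 * n - 2 * h)) *
               of_real (real n - real k / 2 gchoose (n - h)) * of_real (B_coeff k (k - 2 * h - 1)))"
        using h unfolding a_def [symmetric] b_def gbinomial_of_real by (simp add: mult_ac)
    qed
    finally show ?thesis .
  qed
  ultimately have "polar_expansion (real k / 2)
      (\<lambda>s. \<Sum>h=0..(k-2) div 2. b h * quad_series a (k - 2 * h - 1) s) (\<lambda>n. of_real (mp_residue k n))"
    by simp
  thus "polar_expansion (real k / 2) (mp_zeta k) (\<lambda>n. of_real (mp_residue k n))"
    by (rule polar_expansion_cong) (use sums in \<open>auto simp: mp_zeta_def sums_iff\<close>)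
qed

lemma mp_residue_0: "k \<ge> 2 \<Longrightarrow> mp_residue k 0 = 1 / (2 * fact (k - 1))"
  using B_coeff_top[of k] by (simp add: mp_residue_def)

text \<open>With \<open>k = 2 * l\<close> the upper entry is the natural number
  \<open>n - l\<close>, and \<open>h < l\<close> makes it smaller than the lower entry
  \<open>n - h\<close>.\<close>

lemma mp_residue_even:
  assumes "even k" "k \<ge> 2" "n \<ge> k div 2"
  shows "mp_residue k n = 0"
proof -
  obtain l where l: "k = 2 * l" using assms by (elim evenE)
  have "(real n - real k / 2) gchoose (n - h) = 0" if "h \<in> {0..min n ((k - 2) div 2)}" for h
  proof -
    have "real n - real k / 2 = real (n - l)"
      using assms l by (simp add: of_nat_diff)
    moreover have "n - l < n - h"
      using that assms l by auto
    ultimately show ?thesis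
      by (simp flip: binomial_gbinomial)
  qed
  thus ?thesis
    unfolding mp_residue_def by simp
qed

theorem theorem12:
  fixes k :: nat
  assumes "k \<ge> 2"
  shows "\<exists>L :: complex \<Rightarrow> complex.
    L nicely_meromorphic_on UNIV \<and>
    (\<forall>s. Re s > real k / 2 \<longrightarrow>
       summable (\<lambda>n. mp_term k s (Suc n)) \<and> L s = mp_zeta k s) \<and>
    (\<forall>z. is_pole L z \<longrightarrow>
       zorder L z = -1 \<and> (\<exists>n::nat. z = of_real (real k / 2 - real n))) \<and>
    (\<forall>n::nat. residue L (of_real (real k / 2 - real n)) =
       of_real (1 / (4 * fact (k - 1)) *
         (\<Sum>h=0..min n ((k - 2) div 2).
            (-1) ^ (n - h) * ((real k - 1) / 2) ^ (2 * n - 2 * h)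
            * ((real n - real k / 2) gchoose (n - h)) * B_coeff k (k - 2 * h - 1)))) \<and>
    residue L (of_real (real k / 2)) = of_real (1 / (2 * fact (k - 1))) \<and>
    (even k \<longrightarrow> (\<forall>z. is_pole L z \<longrightarrow>
       zorder L z = -1 \<and> (\<exists>m\<in>{1..k div 2}. z = of_nat m)))"
proof -
  obtain L where L: "L nicely_meromorphic_on UNIV"
    "\<And>s. real k / 2 < Re s \<Longrightarrow> L s = mp_zeta k s"
    and pole: "\<And>z. is_pole L z \<Longrightarrow> zorder L z = -1 \<and>
        (\<exists>n. z = complex_of_real (real k / 2 - real n) \<and> complex_of_real (mp_residue k n) \<noteq> 0)"
    and res: "\<And>n. residue L (complex_of_real (real k / 2 - real n)) = of_real (mp_residue k n)"
    using polar_expansion_continuation[OF mp_zeta_expansion(2)[OF assms]] by blast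
  have "residue L (of_real (real k / 2)) = of_real (1 / (2 * fact (k - 1)))"
    using res[of 0] by (simp add: mp_residue_0[OF assms])
  moreover have "\<exists>m\<in>{1..k div 2}. z = of_nat m" if even: "even k" and z: "is_pole L z" for z
  proof -
    obtain n where n: "z = complex_of_real (real k / 2 - real n)" "mp_residue k n \<noteq> 0"
      using pole[OF z] by auto
    \<comment> \<open>The residue at a pole is nonzero, which excludes larger \<open>n\<close>;
      hence \<open>k div 2 - n\<close> is at least 1.\<close>
    have "n < k div 2"
      using mp_residue_even[OF even assms, of n] n(2) by (meson not_le)
    moreover have "real k / 2 = real (k div 2)"
      using even by (simp add: real_of_nat_div)
    ultimately show ?thesis
      unfolding n(1) by (intro bexI[of _ "k div 2 - n"]) (auto simp: of_nat_diff)
  qed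
  ultimately show ?thesis
    using L pole res mp_zeta_expansion(1)[OF assms] unfolding mp_residue_def
    by (intro exI[of _ L] conjI) blast+
qed

end
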